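(* Let $\kappa\geq\omega$ be a cardinal and let $B$ be a coproduct (free product) of boolean algebras each of size at most $\kappa$. Then every subset of $B$ is almost $\kappa^{\mathrm{op}}$-like.
   Context: Subsets of a boolean algebra are ordered by the boolean order. A poset is $\kappa^{\mathrm{op}}$-like if no element is below $\kappa$-many elements of it. A poset $Q$ is almost $\kappa^{\mathrm{op}}$-like if it has a dense subset $D$ (for every $q\in Q$ there is $d\in D$ with $d\leq q$) that is $\kappa^{\mathrm{op}}$-like. *)

theory Defs
  imports Main
begin

text \<open>Boolean algebras are modelled as types of class boolean_algebra; the
  algebra B is the whole type. Subalgebras are subsets closed under the
  operations.\<close>

definition subalgebra :: "'a::boolean_algebra set \<Rightarrow> bool" where
  "subalgebra S \<longleftrightarrow> bot \<in> S \<and> top \<in> S \<and>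
     (\<forall>x\<in>S. - x \<in> S) \<and> (\<forall>x\<in>S. \<forall>y\<in>S. inf x y \<in> S \<and> sup x y \<in> S)"

definition generated_subalgebra :: "'a::boolean_algebra set \<Rightarrow> 'a set" where
  "generated_subalgebra X = \<Inter>{S. subalgebra S \<and> X \<subseteq> S}"

definition independent_family :: "'i set \<Rightarrow> ('i \<Rightarrow> 'a::boolean_algebra set) \<Rightarrow> bool" where
  "independent_family I A \<longleftrightarrow>
     (\<forall>js a. distinct js \<and> set js \<subseteq> I \<and> (\<forall>j\<in>set js. a j \<in> A j \<and> a j \<noteq> bot)
        \<longrightarrow> foldr inf (map a js) top \<noteq> bot)"

text \<open>The (internal) free product: B (the whole type) is the free product
  (coproduct) of the subalgebras A i, i \<in> I, iff these are independent
  subalgebras generating B.\<close>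

definition free_product_of :: "'i set \<Rightarrow> ('i \<Rightarrow> 'a::boolean_algebra set) \<Rightarrow> bool" where
  "free_product_of I A \<longleftrightarrow>
     (\<forall>i\<in>I. subalgebra (A i)) \<and> independent_family I A \<and>
     generated_subalgebra (\<Union>i\<in>I. A i) = UNIV"

definition dense_in :: "'a::order set \<Rightarrow> 'a set \<Rightarrow> bool" where
  "dense_in D Q \<longleftrightarrow> D \<subseteq> Q \<and> (\<forall>q\<in>Q. \<exists>d\<in>D. d \<le> q)"

definition op_like :: "'k rel \<Rightarrow> 'a::order set \<Rightarrow> bool" where
  "op_like \<kappa> P \<longleftrightarrow> (\<forall>p\<in>P. (card_of {q\<in>P. p \<le> q}, \<kappa>) \<in> ordLess)"

definition almost_op_like :: "'k rel \<Rightarrow> 'a::order set \<Rightarrow> bool" where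
  "almost_op_like \<kappa> Q \<longleftrightarrow> (\<exists>D. dense_in D Q \<and> op_like \<kappa> D)"

end

theory Submission
  imports Defs "HOL.Hull"
begin

text \<open>
  Let \<open>B\<^sub>J\<close> be the subalgebra generated by the factors indexed by \<open>J\<close>. Every element of \<open>B\<close> has a
  least upper approximation in \<open>B\<^sub>J\<close>. Fix a subset \<open>Q\<close> of \<open>B\<close> and choose, for each element of \<open>B\<close> that
  lies above some element of \<open>Q\<close>, one such element of \<open>Q\<close>. If \<open>J\<close> is closed under this choice, then
  for each \<open>b \<in> Q\<close> a single element of \<open>Q \<inter> B\<^sub>J\<close> (the choice for the approximation of \<open>b\<close>) lies below
  all elements of \<open>Q \<inter> B\<^sub>J\<close> that are above \<open>b\<close>. By induction on the cardinality of \<open>J\<close>, splitting \<open>J\<close>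
  into an increasing chain of smaller closed sets, \<open>Q\<close> is well-ordered so that each proper initial
  segment is the union of fewer than \<open>\<kappa>\<close> elements and finitely many such sets \<open>Q \<inter> B\<^sub>J\<close>. The elements
  of \<open>Q\<close> with no earlier element of \<open>Q\<close> below them form the dense subset: induction along the
  well-order shows that every element of \<open>Q\<close> has fewer than \<open>\<kappa>\<close> of them above it.
\<close>

unbundle cardinal_syntax

section \<open>Finite covers and layered orders\<close>

text \<open>The elements of \<open>R\<close> need not lie above \<open>b\<close>: they serve as
  earlier elements to which an induction hypothesis applies. Finite sets, rather than single
  elements, make the notion stable under binary unions.\<close>

definition finitely_covered :: "'a::order set \<Rightarrow> 'a set \<Rightarrow> bool" where
  "finitely_covered Q X \<longleftrightarrow>
     (\<forall>b\<in>Q. \<exists>R. finite R \<and> R \<subseteq> X \<and> (\<forall>e\<in>X. b \<le> e \<longrightarrow> (\<exists>r\<in>R. r \<le> e)))"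

lemma finitely_covered_empty: "finitely_covered Q {}"
  by (auto simp: finitely_covered_def)

lemma finitely_covered_Un:
  assumes "finitely_covered Q X" "finitely_covered Q Y"
  shows "finitely_covered Q (X \<union> Y)"
  unfolding finitely_covered_def
proof
  fix b assume b: "b \<in> Q"
  obtain R where R: "finite R" "R \<subseteq> X" "\<forall>e\<in>X. b \<le> e \<longrightarrow> (\<exists>r\<in>R. r \<le> e)"
    using assms(1) b unfolding finitely_covered_def by blast
  obtain S where S: "finite S" "S \<subseteq> Y" "\<forall>e\<in>Y. b \<le> e \<longrightarrow> (\<exists>r\<in>S. r \<le> e)"
    using assms(2) b unfolding finitely_covered_def by blast
  show "\<exists>R. finite R \<and> R \<subseteq> X \<union> Y \<and> (\<forall>e\<in>X \<union> Y. b \<le> e \<longrightarrow> (\<exists>r\<in>R. r \<le> e))"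
    by (rule exI[of _ "R \<union> S"]) (use R S in blast)
qed

text \<open>\<open>Q\<close> is kept apart from \<open>P\<close>: when a set is assembled from
  pieces \<open>P\<close>, the covers found inside one piece must still serve every element of
  \<open>Q\<close>.\<close>

definition layered :: "'k rel \<Rightarrow> 'a::order set \<Rightarrow> 'a set \<Rightarrow> bool" where
  "layered \<kappa> Q P \<longleftrightarrow> (\<exists>L. wf L \<and> total_on P L \<and>
     (\<forall>x\<in>P. \<exists>S X. |S| <o \<kappa> \<and> finitely_covered Q X \<and> {y\<in>P. (y, x) \<in> L} = S \<union> X))"

lemma card_of_finite_ordLess_Cinfinite: "finite X \<Longrightarrow> Cinfinite r \<Longrightarrow> |X| <o r"
  by (rule Cfinite_ordLess_Cinfinite) (simp_all add: cfinite_def Field_card_of card_of_card_order_on)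

text \<open>With finite unions this holds for singular \<open>\<kappa>\<close> too, which is the
  reason for asking covers to be finite.\<close>

lemma card_of_finite_UN_ordLess:
  assumes "Cinfinite \<kappa>" "finite R" "\<forall>r\<in>R. |F r| <o \<kappa>"
  shows "|\<Union>r\<in>R. F r| <o \<kappa>"
  using assms(2,3)
proof (induction R)
  case empty
  show ?case by (simp add: card_of_finite_ordLess_Cinfinite assms(1))
next
  case (insert x R)
  then show ?case
    using card_of_Un_ordLess_infinite_Field[of \<kappa> "F x" "\<Union>r\<in>R. F r"] assms(1)
    by (simp add: cinfinite_def)
qed

text \<open>The witness consists of the elements of \<^term>\<open>Q\<close> that lie above no \<^term>\<open>L\<close>-earlier element;
  an element above \<^term>\<open>d\<close> in it must then come \<^term>\<open>L\<close>-before \<^term>\<open>d\<close>.\<close>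

lemma almost_op_like_layered:
  fixes Q :: "'a::order set"
  assumes \<kappa>: "Cinfinite \<kappa>" and "layered \<kappa> Q Q"
  shows "almost_op_like \<kappa> Q"
proof -
  obtain L where L: "wf L" "total_on Q L"
    and seg: "\<And>x. x \<in> Q \<Longrightarrow>
      \<exists>S X. |S| <o \<kappa> \<and> finitely_covered Q X \<and> {y\<in>Q. (y, x) \<in> L} = S \<union> X"
    using assms(2) unfolding layered_def by blast
  define D where "D = {q\<in>Q. \<forall>q'\<in>Q. (q', q) \<in> L \<longrightarrow> \<not> q' \<le> q}"
  have "dense_in D Q"
    unfolding dense_in_def
  proof (intro conjI ballI)
    fix q assume "q \<in> Q"
    then obtain d where d: "d \<in> {x\<in>Q. x \<le> q}" "\<And>y. (y, d) \<in> L \<Longrightarrow> y \<notin> {x\<in>Q. x \<le> q}"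
      using wfE_min[OF L(1), of q "{x\<in>Q. x \<le> q}"] by auto
    then have "d \<in> D" unfolding D_def using order.trans by blast
    with d show "\<exists>d\<in>D. d \<le> q" by blast
  qed (auto simp: D_def)
  moreover have "p \<in> Q \<longrightarrow> |{q\<in>D. p \<le> q}| <o \<kappa>" for p
    using L(1)
  proof (induction p rule: wf_induct_rule)
    case (less p)
    show ?case
    proof
      assume p: "p \<in> Q"
      then obtain S X where S: "|S| <o \<kappa>" and X: "finitely_covered Q X"
        and SX: "{y\<in>Q. (y, p) \<in> L} = S \<union> X"
        using seg by blast
      obtain R where R: "finite R" "R \<subseteq> X" "\<forall>e\<in>X. p \<le> e \<longrightarrow> (\<exists>r\<in>R. r \<le> e)"
        using X p unfolding finitely_covered_def by blast
      \<comment> \<open>An element of \<open>D\<close> above \<open>p\<close> is \<open>p\<close>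
        itself or comes before \<open>p\<close>. If it falls into \<open>X\<close>, it is above some
        member of \<open>R\<close>, and that member precedes \<open>p\<close>, so the induction
        hypothesis bounds how many such elements there are.\<close>
      have "{q\<in>D. p \<le> q} \<subseteq> ({p} \<union> S) \<union> (\<Union>r\<in>R. {q\<in>D. r \<le> q})"
      proof
        fix q assume q: "q \<in> {q\<in>D. p \<le> q}"
        then have "(p, q) \<notin> L" "q \<in> Q" using p by (auto simp: D_def)
        then have "q = p \<or> (q, p) \<in> L" using L(2) p unfolding total_on_def by blast
        then have "q = p \<or> q \<in> S \<or> q \<in> X" using SX \<open>q \<in> Q\<close> by blast
        then show "q \<in> ({p} \<union> S) \<union> (\<Union>r\<in>R. {q\<in>D. r \<le> q})" using R(3) q by blast
      qed
      moreover have "|\<Union>r\<in>R. {q\<in>D. r \<le> q}| <o \<kappa>"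
        using less R SX by (intro card_of_finite_UN_ordLess[OF \<kappa>]) blast+
      moreover have "|{p}| <o \<kappa>"
        by (simp add: card_of_finite_ordLess_Cinfinite \<kappa>)
      ultimately show "|{q\<in>D. p \<le> q}| <o \<kappa>"
        using card_of_Un_ordLess_infinite_Field[of \<kappa>] S \<kappa> card_of_mono1 ordLeq_ordLess_trans
        unfolding cinfinite_def by meson
    qed
  qed
  then have "op_like \<kappa> D" unfolding op_like_def by (simp add: D_def)
  ultimately show ?thesis unfolding almost_op_like_def by blast
qed

text \<open>Along a well-order of least possible type, proper initial segments are smaller than
  \<open>P\<close>, so the covered part can be empty.\<close>

lemma layered_small:
  assumes "|P| \<le>o \<kappa>"
  shows "layered \<kappa> Q P"
proof -
  define r where "r = |P|"
  have r: "Well_order r" "Field r = P" "Card_order r"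
    unfolding r_def by (auto simp: Field_card_of card_of_card_order_on card_of_well_order_on)
  have "wf (r - Id)" using r(1) by (simp add: well_order_on_def)
  moreover have "total_on P (r - Id)"
    using r(1,2) unfolding well_order_on_def linear_order_on_def total_on_def by blast
  moreover have "\<exists>S X. |S| <o \<kappa> \<and> finitely_covered Q X \<and> {y\<in>P. (y, x) \<in> r - Id} = S \<union> X"
    if "x \<in> P" for x
  proof (intro exI conjI)
    show "|underS r x| <o \<kappa>"
      using card_of_underS[OF r(3), of x] that r(2) assms ordLess_ordLeq_trans
      unfolding r_def by blast
    show "{y\<in>P. (y, x) \<in> r - Id} = underS r x \<union> {}"
      using r(2) unfolding underS_def Field_def by blast
  qed (rule finitely_covered_empty)
  ultimately show ?thesis unfolding layered_def by blast
qed

text \<open>Order the union first by the least index at which an element appears, then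
  by the order of that piece: the elements before \<^term>\<open>x\<close> are all elements of earlier pieces
  together with the predecessors of \<^term>\<open>x\<close> inside its own piece.\<close>

lemma layered_UN:
  fixes H :: "'j \<Rightarrow> 'a::order set"
  assumes r: "Well_order r"
    and H: "\<And>k. k \<in> Field r \<Longrightarrow> layered \<kappa> Q (H k)"
    and U: "\<And>k. k \<in> Field r \<Longrightarrow> finitely_covered Q (\<Union>l\<in>underS r k. H l)"
  shows "layered \<kappa> Q (\<Union>k\<in>Field r. H k)"
proof -
  have wfr: "wf (r - Id)" using r by (simp add: well_order_on_def)
  have tot: "k = l \<or> (k, l) \<in> r \<or> (l, k) \<in> r" if "k \<in> Field r" "l \<in> Field r" for k l
    using r that unfolding well_order_on_def linear_order_on_def total_on_def by blast
  have antisymr: "k = l" if "(k, l) \<in> r" "(l, k) \<in> r" for k l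
    using r that
    unfolding well_order_on_def linear_order_on_def partial_order_on_def antisym_def by blast
  have transr: "(k, m) \<in> r" if "(k, l) \<in> r" "(l, m) \<in> r" for k l m
    using r that
    unfolding well_order_on_def linear_order_on_def partial_order_on_def preorder_on_def trans_def
    by blast
  have "\<forall>k\<in>Field r. \<exists>L. wf L \<and> total_on (H k) L \<and>
     (\<forall>x\<in>H k. \<exists>S X. |S| <o \<kappa> \<and> finitely_covered Q X \<and> {y\<in>H k. (y, x) \<in> L} = S \<union> X)"
    using H unfolding layered_def by blast
  from bchoice[OF this] obtain W where W: "\<And>k. k \<in> Field r \<Longrightarrow> wf (W k) \<and> total_on (H k) (W k) \<and>
     (\<forall>x\<in>H k. \<exists>S X. |S| <o \<kappa> \<and> finitely_covered Q X \<and> {y\<in>H k. (y, x) \<in> W k} = S \<union> X)"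
    by blast
  let ?P = "\<Union>k\<in>Field r. H k"
  have "\<exists>k\<in>Field r. x \<in> H k \<and> (\<forall>l\<in>Field r. x \<in> H l \<longrightarrow> k = l \<or> (k, l) \<in> r)" if "x \<in> ?P" for x
  proof -
    from that obtain k where "k \<in> {k\<in>Field r. x \<in> H k}" by blast
    then obtain k where "k \<in> {k\<in>Field r. x \<in> H k}"
      "\<And>l. (l, k) \<in> r - Id \<Longrightarrow> l \<notin> {k\<in>Field r. x \<in> H k}"
      using wfE_min[OF wfr, of k "{k\<in>Field r. x \<in> H k}"] by blast
    then show ?thesis using tot by blast
  qed
  \<comment> \<open>\<open>f x\<close> is the first index whose piece contains
    \<open>x\<close>.\<close>
  then obtain f where f: "\<And>x. x \<in> ?P \<Longrightarrow> f x \<in> Field r" "\<And>x. x \<in> ?P \<Longrightarrow> x \<in> H (f x)"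
    "\<And>x l. x \<in> ?P \<Longrightarrow> l \<in> Field r \<Longrightarrow> x \<in> H l \<Longrightarrow> f x = l \<or> (f x, l) \<in> r"
    by metis
  define L where "L = {(y, x). y \<in> ?P \<and> x \<in> ?P \<and>
     ((f y, f x) \<in> r - Id \<or> f y = f x \<and> (y, x) \<in> W (f x))}"
  have "wf L"
  proof (rule wfI_min)
    fix x and A :: "'a set"
    assume xA: "x \<in> A"
    show "\<exists>z\<in>A. \<forall>y. (y, z) \<in> L \<longrightarrow> y \<notin> A"
    proof (cases "A \<inter> ?P = {}")
      case True
      then have "\<forall>y. (y, x) \<in> L \<longrightarrow> y \<notin> A" unfolding L_def by blast
      then show ?thesis using xA by blast
    next
      case False
      then obtain a where "f a \<in> f ` (A \<inter> ?P)" by blast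
      from wfr this obtain k where k: "k \<in> f ` (A \<inter> ?P)"
        "\<And>l. (l, k) \<in> r - Id \<Longrightarrow> l \<notin> f ` (A \<inter> ?P)"
        by (rule wfE_min) blast
      then obtain b where b: "b \<in> {x\<in>A \<inter> ?P. f x = k}" by blast
      then have "k \<in> Field r" using f(1) by blast
      then have "wf (W k)" using W by blast
      from this b obtain z where "z \<in> {x\<in>A \<inter> ?P. f x = k}"
        "\<And>y. (y, z) \<in> W k \<Longrightarrow> y \<notin> {x\<in>A \<inter> ?P. f x = k}"
        by (rule wfE_min) blast
      then show ?thesis using k(2) unfolding L_def by blast
    qed
  qed
  moreover have "total_on ?P L"
    unfolding total_on_def
  proof (intro ballI impI)
    fix x y assume xy: "x \<in> ?P" "y \<in> ?P" "x \<noteq> y"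
    show "(x, y) \<in> L \<or> (y, x) \<in> L"
    proof (cases "f x = f y")
      case True
      then have "x \<in> H (f x)" "y \<in> H (f x)" "total_on (H (f x)) (W (f x))"
        using xy f W by metis+
      then have "(x, y) \<in> W (f x) \<or> (y, x) \<in> W (f x)" using xy unfolding total_on_def by blast
      then show ?thesis using True xy unfolding L_def by auto
    next
      case False
      then show ?thesis using tot[of "f x" "f y"] f(1) xy unfolding L_def by auto
    qed
  qed
  moreover have "\<exists>S X. |S| <o \<kappa> \<and> finitely_covered Q X \<and> {y\<in>?P. (y, x) \<in> L} = S \<union> X"
    if x: "x \<in> ?P" for x
  proof -
    have fx: "f x \<in> Field r" "x \<in> H (f x)" using f x by blast+
    obtain S X where S: "|S| <o \<kappa>" and X: "finitely_covered Q X"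
      and SX: "{y\<in>H (f x). (y, x) \<in> W (f x)} = S \<union> X"
      using W[OF fx(1)] fx(2) by blast
    have "{y\<in>?P. (y, x) \<in> L} =
      (\<Union>l\<in>underS r (f x). H l) \<union> {y\<in>H (f x). (y, x) \<in> W (f x)}" (is "?A = ?B \<union> ?C")
    proof
      show "?A \<subseteq> ?B \<union> ?C" using f(2) unfolding L_def underS_def by fastforce
      show "?B \<union> ?C \<subseteq> ?A"
      proof
        fix y assume "y \<in> ?B \<union> ?C"
        then show "y \<in> ?A"
        proof
          assume "y \<in> ?B"
          then obtain l where l: "l \<noteq> f x" "(l, f x) \<in> r" "y \<in> H l" unfolding underS_def by blast
          then have lr: "l \<in> Field r" unfolding Field_def by blast
          then have y: "y \<in> ?P" using l by blast
          have "f y = l \<or> (f y, l) \<in> r" by (rule f(3)[OF y lr l(3)])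
          then have "(f y, f x) \<in> r - Id" 
            using l(1,2) transr[of "f y" l "f x"] antisymr[of l "f x"] by auto
          then show ?thesis using x y unfolding L_def by blast
        next
          assume yC: "y \<in> ?C"
          then have y: "y \<in> ?P" using fx by blast
          \<comment> \<open>\<open>y\<close> may already have appeared in an earlier piece; it
            precedes \<open>x\<close> in either case.\<close>
          have "f y = f x \<or> (f y, f x) \<in> r" using f(3)[OF y fx(1)] yC by blast
          then show ?thesis using x y yC unfolding L_def by blast
        qed
      qed
    qed
    \<comment> \<open>All earlier pieces together go into the covered part, so the small part still
      comes from one piece only.\<close>
    then have "?A = S \<union> (X \<union> ?B)" using SX by blast
    then show ?thesis using S finitely_covered_Un[OF X U[OF fx(1)]] by blast
  qed
  ultimately show ?thesis unfolding layered_def by blast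
qed

section \<open>Size of closures reached in countably many stages\<close>

lemma card_of_funpow_closure:
  fixes F :: "'b set \<Rightarrow> 'b set"
  assumes r: "Cinfinite r" and X: "|X| \<le>o r"
    and F: "\<And>Y. |Y| \<le>o r \<Longrightarrow> |F Y| \<le>o r"
  shows "|\<Union>n::nat. (F ^^ n) X| \<le>o r"
proof -
  have "|(F ^^ n) X| \<le>o r" for n
    by (induction n) (auto simp: X F)
  moreover have "|UNIV :: nat set| \<le>o r"
    using natLeq_ordLeq_cinfinite[OF r] card_of_nat ordIso_ordLeq_trans by blast
  ultimately show ?thesis
    using r by (intro card_of_UNION_ordLeq_infinite_Field) (auto simp: cinfinite_def)
qed

section \<open>Finite meets and disjunctive normal forms in a free product\<close>

text \<open>A relation on index sets replaces the \<open>foldr\<close> over lists in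
  \<open>independent_family\<close>, so that unions and intersections of index sets can be handled
  without enumerations.\<close>

definition is_meet :: "'i set \<Rightarrow> ('i \<Rightarrow> 'a::boolean_algebra) \<Rightarrow> 'a \<Rightarrow> bool" where
  "is_meet F a m \<longleftrightarrow> (\<forall>x. x \<le> m \<longleftrightarrow> (\<forall>i\<in>F. x \<le> a i))"

lemma is_meet_le: "is_meet F a m \<Longrightarrow> i \<in> F \<Longrightarrow> m \<le> a i"
  unfolding is_meet_def by blast

lemma is_meet_unique: "is_meet F a m \<Longrightarrow> is_meet F a n \<Longrightarrow> m = n"
  unfolding is_meet_def by (meson order.antisym order.refl)

lemma is_meet_foldr: "is_meet (set js) a (foldr inf (map a js) top)"
  unfolding is_meet_def by (induction js) auto

lemma is_meet_exists: "finite F \<Longrightarrow> \<exists>m. is_meet F a m"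
  using is_meet_foldr finite_list by metis

lemma is_meet_empty: "is_meet {} a m \<longleftrightarrow> m = top"
  unfolding is_meet_def by (auto intro: top_le)

lemma is_meet_insert: "is_meet F a m \<Longrightarrow> is_meet (insert i F) a (inf (a i) m)"
  unfolding is_meet_def by auto

locale free_product =
  fixes I :: "'i set" and A :: "'i \<Rightarrow> 'a::boolean_algebra set"
  assumes free_product: "free_product_of I A"
begin

lemma factor_closed:
  assumes "i \<in> I"
  shows "bot \<in> A i" "top \<in> A i" "x \<in> A i \<Longrightarrow> - x \<in> A i"
    "x \<in> A i \<Longrightarrow> y \<in> A i \<Longrightarrow> inf x y \<in> A i"
  using free_product assms unfolding free_product_of_def subalgebra_def by auto

lemma is_meet_nonzero:
  assumes "finite F" "F \<subseteq> I" "\<forall>i\<in>F. a i \<in> A i \<and> a i \<noteq> bot" "is_meet F a m"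
  shows "m \<noteq> bot"
proof -
  obtain js where js: "set js = F" "distinct js" using finite_distinct_list[OF assms(1)] by blast
  then have "foldr inf (map a js) top \<noteq> bot"
    using free_product assms(2,3) unfolding free_product_of_def independent_family_def by blast
  then show ?thesis using is_meet_unique[OF assms(4)] is_meet_foldr[of js a] js by metis
qed

text \<open>The algebraic counterpart of basic open boxes in a product space. Components may be
  \<open>bot\<close>, so a box can be zero; the empty \<open>F\<close> yields
  \<open>top\<close>.\<close>

definition boxes :: "'i set \<Rightarrow> 'a set" where
  "boxes J = {m. \<exists>F a. finite F \<and> F \<subseteq> J \<and> (\<forall>i\<in>F. a i \<in> A i) \<and> is_meet F a m}"

text \<open>For \<^prop>\<open>J \<subseteq> I\<close> this is the subalgebra generated by the factors with index in \<^term>\<open>J\<close>,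
  in disjunctive normal form.\<close>

inductive_set span :: "'i set \<Rightarrow> 'a set" for J where
  bot: "bot \<in> span J"
| sup: "m \<in> boxes J \<Longrightarrow> n \<in> span J \<Longrightarrow> sup m n \<in> span J"

lemma box_in_span: "m \<in> boxes J \<Longrightarrow> m \<in> span J"
  using span.sup[OF _ span.bot] by fastforce

lemma top_in_boxes: "top \<in> boxes J"
  unfolding boxes_def using is_meet_empty by blast

lemma factor_in_boxes: "i \<in> J \<Longrightarrow> x \<in> A i \<Longrightarrow> x \<in> boxes J"
  unfolding boxes_def by (rule CollectI, rule exI[of _ "{i}"], rule exI[of _ "\<lambda>_. x"])
    (simp add: is_meet_def)

lemma boxes_inf:
  assumes "J \<subseteq> I" "m \<in> boxes J" "n \<in> boxes J"
  shows "inf m n \<in> boxes J"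
proof -
  obtain F a where F: "finite F" "F \<subseteq> J" "\<forall>i\<in>F. a i \<in> A i" "is_meet F a m"
    using assms(2) unfolding boxes_def by blast
  obtain G b where G: "finite G" "G \<subseteq> J" "\<forall>i\<in>G. b i \<in> A i" "is_meet G b n"
    using assms(3) unfolding boxes_def by blast
  \<comment> \<open>Missing coordinates are padded with \<open>top\<close>; common ones are met
    inside their factor.\<close>
  define c where "c i = inf (if i \<in> F then a i else top) (if i \<in> G then b i else top)" for i
  have "\<forall>i\<in>F \<union> G. c i \<in> A i"
    using F G assms(1) factor_closed unfolding c_def by auto
  moreover have "is_meet (F \<union> G) c (inf m n)"
    using F(4) G(4) unfolding is_meet_def c_def by auto
  ultimately show ?thesis
    unfolding boxes_def using F(1,2) G(1,2) by blast
qed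

lemma span_sup: "m \<in> span J \<Longrightarrow> n \<in> span J \<Longrightarrow> sup m n \<in> span J"
  by (induction m rule: span.induct) (auto simp: sup_assoc intro: span.intros)

lemma span_inf:
  assumes J: "J \<subseteq> I" and m: "m \<in> span J" and n: "n \<in> span J"
  shows "inf m n \<in> span J"
proof -
  have *: "inf b n \<in> span J" if "b \<in> boxes J" for b
    using n by (induction n rule: span.induct)
      (auto simp: inf_sup_distrib1 intro: span.intros boxes_inf[OF J that])
  show ?thesis
    using m by (induction m rule: span.induct)
      (auto simp: inf_sup_distrib2 intro: span.intros span_sup *)
qed

text \<open>De Morgan: the complement of a box is the join of the complements of its components,
  each of which stays in its factor.\<close>

lemma box_compl_in_span:
  assumes J: "J \<subseteq> I" and m: "m \<in> boxes J"
  shows "- m \<in> span J"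
proof -
  obtain F a where F: "finite F" "F \<subseteq> J" "\<forall>i\<in>F. a i \<in> A i" "is_meet F a m"
    using m unfolding boxes_def by blast
  then show ?thesis
  proof (induction F arbitrary: m)
    case empty
    then show ?case by (simp add: is_meet_empty span.bot)
  next
    case (insert i F)
    obtain n where n: "is_meet F a n" using is_meet_exists insert.hyps by blast
    have "m = inf (a i) n"
      by (rule is_meet_unique[OF insert.prems(3) is_meet_insert[OF n]])
    moreover have "- n \<in> span J" using insert n by blast
    moreover have "- a i \<in> boxes J"
      using insert.prems J factor_closed(3) factor_in_boxes by auto
    ultimately show ?case by (auto intro: span.sup)
  qed
qed

lemma span_compl:
  assumes J: "J \<subseteq> I" and m: "m \<in> span J"
  shows "- m \<in> span J"
  using m
  by (induction m rule: span.induct)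
    (auto intro: span_inf[OF J] box_compl_in_span[OF J] box_in_span top_in_boxes)

lemma span_UNIV: "span I = UNIV"
proof -
  have "subalgebra (span I)"
    unfolding subalgebra_def
    by (intro conjI ballI span.bot box_in_span[OF top_in_boxes] span_compl[OF order.refl]
        span_inf[OF order.refl] span_sup)
  moreover have "(\<Union>i\<in>I. A i) \<subseteq> span I" using factor_in_boxes box_in_span by blast
  ultimately have "generated_subalgebra (\<Union>i\<in>I. A i) \<subseteq> span I"
    unfolding generated_subalgebra_def by blast
  then show ?thesis using free_product unfolding free_product_of_def by blast
qed

lemma span_mono: "J \<subseteq> K \<Longrightarrow> span J \<subseteq> span K"
proof
  fix m assume JK: "J \<subseteq> K" and "m \<in> span J"
  have "boxes J \<subseteq> boxes K" using JK unfolding boxes_def by blast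
  with \<open>m \<in> span J\<close> show "m \<in> span K"
    by (induction m rule: span.induct) (auto intro: span.intros)
qed

text \<open>A join of finitely many boxes involves finitely many indices. This yields finite
  supports and continuity of \<open>span\<close> along chains.\<close>

lemma span_finitary:
  assumes "m \<in> span J"
  obtains F where "finite F" "F \<subseteq> J" "m \<in> span F"
proof -
  have "\<exists>F. finite F \<and> F \<subseteq> J \<and> m \<in> span F"
    using assms
  proof (induction m rule: span.induct)
    case bot
    then show ?case using span.bot by blast
  next
    case (sup m n)
    then obtain F where F: "finite F" "F \<subseteq> J" "n \<in> span F" by blast
    obtain G where G: "finite G" "G \<subseteq> J" "m \<in> boxes G"
      using sup.hyps(1) unfolding boxes_def by blast
    have "m \<in> span (F \<union> G)" "n \<in> span (F \<union> G)"
      using F G box_in_span span_mono[of F "F \<union> G"] span_mono[of G "F \<union> G"] by blast+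
    then show ?case using F G span_sup by (metis finite_UnI le_sup_iff)
  qed
  then show ?thesis using that by blast
qed

lemma box_below:
  assumes "p \<in> span J" "p \<noteq> bot"
  shows "\<exists>c\<in>boxes J. c \<noteq> bot \<and> c \<le> p"
  using assms
proof (induction p rule: span.induct)
  case (sup m n)
  show ?case
  proof (cases "m = bot")
    case True
    then show ?thesis using sup by auto
  next
    case False
    then show ?thesis using sup.hyps(1) sup_ge1 by blast
  qed
qed simp

section \<open>Least upper approximations in a subproduct\<close>

text \<open>The approximation keeps the coordinates of \<open>m\<close> in \<open>J\<close> and
  forgets the others. If it were not below \<open>e\<close>, a nonzero box below
  \<open>inf r (- e)\<close> could be combined with the forgotten coordinates; independence makes
  the result nonzero, yet it lies below both \<open>e\<close> and \<open>- e\<close>.\<close>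

lemma box_projection:
  assumes J: "J \<subseteq> I" and m: "m \<in> boxes I" "m \<noteq> bot"
  shows "\<exists>r\<in>boxes J. m \<le> r \<and> (\<forall>e\<in>span J. m \<le> e \<longrightarrow> r \<le> e)"
proof -
  obtain F a where F: "finite F" "F \<subseteq> I" "\<forall>i\<in>F. a i \<in> A i" "is_meet F a m"
    using m unfolding boxes_def by blast
  have nz: "a i \<noteq> bot" if "i \<in> F" for i
    using is_meet_le[OF F(4) that] m(2) by (auto simp: bot_unique)
  obtain r where r: "is_meet (F \<inter> J) a r" using is_meet_exists F(1) by blast
  have "r \<in> boxes J" unfolding boxes_def using F r by blast
  moreover have "m \<le> r" using r is_meet_le[OF F(4)] unfolding is_meet_def by blast
  moreover have "r \<le> e" if e: "e \<in> span J" "m \<le> e" for e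
  proof (rule ccontr)
    assume "\<not> r \<le> e"
    then have "inf r (- e) \<noteq> bot" by (metis double_compl inf_shunt)
    moreover have "inf r (- e) \<in> span J"
      using span_inf[OF J box_in_span[OF \<open>r \<in> boxes J\<close>] span_compl[OF J e(1)]] .
    ultimately obtain c where c: "c \<in> boxes J" "c \<noteq> bot" "c \<le> inf r (- e)"
      using box_below by blast
    obtain G b where G: "finite G" "G \<subseteq> J" "\<forall>i\<in>G. b i \<in> A i" "is_meet G b c"
      using c(1) unfolding boxes_def by blast
    have nz': "b i \<noteq> bot" if "i \<in> G" for i
      using is_meet_le[OF G(4) that] c(2) by (auto simp: bot_unique)
    \<comment> \<open>Coordinates of \<open>c\<close> inside \<open>J\<close>, those of
      \<open>m\<close> outside. Since \<open>c \<le> r\<close>, the former also bound the meet by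
      the coordinates of \<open>m\<close> in \<open>J\<close>.\<close>
    define d where "d i = (if i \<in> J then b i else a i)" for i
    obtain u where u: "is_meet (G \<union> (F - J)) d u"
      using is_meet_exists F(1) G(1) by (meson finite_Diff finite_UnI)
    have "u \<noteq> bot"
    proof (rule is_meet_nonzero[OF _ _ _ u])
      show "\<forall>i\<in>G \<union> (F - J). d i \<in> A i \<and> d i \<noteq> bot"
        using F(3) G(2,3) nz nz' unfolding d_def by auto
    qed (use F G J in auto)
    moreover have "u \<le> bot"
    proof -
      have "u \<le> b i" if "i \<in> G" for i
        using is_meet_le[OF u, of i] that G(2) unfolding d_def by auto
      then have "u \<le> c" using G(4) unfolding is_meet_def by blast
      then have ur: "u \<le> r" "u \<le> - e" using c(3) by auto
      have "u \<le> a i" if "i \<in> F" for i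
      proof (cases "i \<in> J")
        case True
        then show ?thesis using is_meet_le[OF r, of i] that ur(1) by (meson IntI order.trans)
      next
        case False
        then show ?thesis using is_meet_le[OF u, of i] that unfolding d_def by auto
      qed
      then have "u \<le> m" using F(4) unfolding is_meet_def by blast
      then have "u \<le> inf e (- e)" using ur(2) e(2) by (meson inf_greatest order.trans)
      then show ?thesis by simp
    qed
    ultimately show False by (simp add: bot_unique)
  qed
  ultimately show ?thesis by blast
qed

text \<open>The join of the approximations of the boxes in a normal form approximates their
  join.\<close>

lemma span_projection:
  assumes J: "J \<subseteq> I"
  shows "\<exists>r\<in>span J. m \<le> r \<and> (\<forall>e\<in>span J. m \<le> e \<longrightarrow> r \<le> e)"
proof -
  have "m \<in> span I" by (simp add: span_UNIV)
  then show ?thesis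
  proof (induction m rule: span.induct)
    case bot
    then show ?case using span.bot by blast
  next
    case (sup m n)
    then obtain s where s: "s \<in> span J" "n \<le> s" "\<forall>e\<in>span J. n \<le> e \<longrightarrow> s \<le> e" by blast
    show ?case
    \<comment> \<open>Forgetting coordinates could lose a zero component and so fails for a zero
      box, but such a box adds nothing to the join.\<close>
    proof (cases "m = bot")
      case True
      then show ?thesis using s by auto
    next
      case False
      then obtain r where r: "r \<in> boxes J" "m \<le> r" "\<forall>e\<in>span J. m \<le> e \<longrightarrow> r \<le> e"
        using box_projection[OF J sup.hyps(1)] by blast
      show ?thesis
        by (rule bexI[of _ "sup r s"]) (use r s in \<open>auto intro: span.sup le_supI1 le_supI2\<close>)
    qed
  qed
qed

section \<open>Cardinality of subproducts\<close>

lemma card_of_span: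
  assumes r: "Cinfinite r" and J: "|J| \<le>o r" and A: "\<forall>i\<in>J. |A i| \<le>o r"
  shows "|span J| \<le>o r"
proof -
  define Y where "Y = {bot, top} \<union> (\<Union>i\<in>J. A i)"
  define F where "F Z = Z \<union> (\<lambda>(x, y). inf x y) ` (Z \<times> Z) \<union> (\<lambda>(x, y). sup x y) ` (Z \<times> Z)"
    for Z :: "'a set"
  note inf = conjunct1[OF r, unfolded cinfinite_def] and co = conjunct2[OF r]
  have "|{bot, top} :: 'a set| \<le>o r"
    by (intro ordLess_imp_ordLeq card_of_finite_ordLess_Cinfinite r) simp
  moreover have "|\<Union>i\<in>J. A i| \<le>o r"
    using card_of_UNION_ordLeq_infinite_Field[OF inf co J A] .
  ultimately have Y: "|Y| \<le>o r"
    unfolding Y_def by (rule card_of_Un_ordLeq_infinite_Field[OF inf _ _ co])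
  have F: "|F Z| \<le>o r" if Z: "|Z| \<le>o r" for Z
  proof -
    have "|h ` (Z \<times> Z)| \<le>o r" for h :: "_ \<Rightarrow> 'a"
      by (rule ordLeq_transitive[OF card_of_image
            card_of_Times_ordLeq_infinite_Field[OF inf Z Z co]])
    then show ?thesis
      unfolding F_def by (intro card_of_Un_ordLeq_infinite_Field[OF inf _ _ co] Z)
  qed
  \<comment> \<open>Closing \<open>Y\<close> under binary meets and joins in countably many stages
    captures all of \<open>span J\<close>; each stage stays within \<open>r\<close> because an
    infinite cardinal equals its square.\<close>
  define T where "T = (\<Union>n::nat. (F ^^ n) Y)"
  have mono: "mono (\<lambda>n. (F ^^ n) Y)"
    unfolding mono_iff_le_Suc by (auto simp: F_def)
  have closed: "inf x y \<in> T \<and> sup x y \<in> T" if "x \<in> T" "y \<in> T" for x y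
  proof -
    from that obtain k l where "x \<in> (F ^^ k) Y" "y \<in> (F ^^ l) Y" unfolding T_def by blast
    then have "x \<in> (F ^^ max k l) Y" "y \<in> (F ^^ max k l) Y"
      using monoD[OF mono, of k "max k l"] monoD[OF mono, of l "max k l"] by auto
    then have "inf x y \<in> (F ^^ Suc (max k l)) Y" "sup x y \<in> (F ^^ Suc (max k l)) Y"
      by (auto simp: F_def image_iff)
    then show ?thesis unfolding T_def by blast
  qed
  have "Y \<subseteq> T" unfolding T_def using UN_upper[of 0 UNIV "\<lambda>n. (F ^^ n) Y"] by simp
  have boxT: "m \<in> T" if m: "m \<in> boxes J" for m
  proof -
    obtain G a where G: "finite G" "G \<subseteq> J" "\<forall>i\<in>G. a i \<in> A i" "is_meet G a m"
      using m unfolding boxes_def by blast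
    then show ?thesis
    proof (induction G arbitrary: m)
      case empty
      then show ?case using \<open>Y \<subseteq> T\<close> unfolding Y_def by (simp add: is_meet_empty)
    next
      case (insert i G)
      obtain n where n: "is_meet G a n" using is_meet_exists insert.hyps by blast
      have "m = inf (a i) n"
      by (rule is_meet_unique[OF insert.prems(3) is_meet_insert[OF n]])
      moreover have "n \<in> T" using insert n by blast
      moreover have "a i \<in> T" using insert.prems \<open>Y \<subseteq> T\<close> unfolding Y_def by blast
      ultimately show ?case using closed by blast
    qed
  qed
  have "m \<in> T" if "m \<in> span J" for m
    using that by (induction m rule: span.induct) (use boxT closed \<open>Y \<subseteq> T\<close> Y_def in auto)
  moreover have "|T| \<le>o r" unfolding T_def by (rule card_of_funpow_closure[OF r Y F])
  ultimately show ?thesis by (meson card_of_mono1 ordLeq_transitive subsetI)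
qed

section \<open>Supports, chosen witnesses and closed index sets\<close>

text \<open>An arbitrarily chosen finite support, not a least one.\<close>

definition supp :: "'a \<Rightarrow> 'i set" where
  "supp b = (SOME F. finite F \<and> F \<subseteq> I \<and> b \<in> span F)"

definition lower_witness :: "'a set \<Rightarrow> 'a \<Rightarrow> 'a" where
  "lower_witness Q r = (SOME q. q \<in> Q \<and> q \<le> r)"

text \<open>Bounding the support, instead of asking for membership in \<open>span J\<close>, makes
  closure under intersections immediate.\<close>

definition witness_closed :: "'a set \<Rightarrow> 'i set \<Rightarrow> bool" where
  "witness_closed Q J \<longleftrightarrow>
     (\<forall>r\<in>span J. (\<exists>q\<in>Q. q \<le> r) \<longrightarrow> supp (lower_witness Q r) \<subseteq> J)"

lemma supp: "finite (supp b)" "supp b \<subseteq> I" "b \<in> span (supp b)"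
proof -
  have "\<exists>F. finite F \<and> F \<subseteq> I \<and> b \<in> span F" using span_UNIV span_finitary by (metis UNIV_I)
  then have "finite (supp b) \<and> supp b \<subseteq> I \<and> b \<in> span (supp b)"
    unfolding supp_def by (rule someI_ex)
  then show "finite (supp b)" "supp b \<subseteq> I" "b \<in> span (supp b)" by blast+
qed

lemma lower_witness:
  assumes "\<exists>q\<in>Q. q \<le> r"
  shows "lower_witness Q r \<in> Q" "lower_witness Q r \<le> r"
proof -
  have "lower_witness Q r \<in> Q \<and> lower_witness Q r \<le> r"
    unfolding lower_witness_def
    by (rule someI_ex[of "\<lambda>q. q \<in> Q \<and> q \<le> r"]) (use assms in blast)
  then show "lower_witness Q r \<in> Q" "lower_witness Q r \<le> r" by blast+
qed

text \<open>The covers here are singletons; larger finite ones arise through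
  \<open>finitely_covered_Un\<close>.\<close>

lemma finitely_covered_span:
  assumes J: "J \<subseteq> I" "witness_closed Q J"
  shows "finitely_covered Q (Q \<inter> span J)"
  unfolding finitely_covered_def
proof
  fix b assume b: "b \<in> Q"
  obtain r where r: "r \<in> span J" "b \<le> r" "\<forall>e\<in>span J. b \<le> e \<longrightarrow> r \<le> e"
    using span_projection[OF J(1)] by blast
  then have *: "\<exists>q\<in>Q. q \<le> r" using b by blast
  then have "lower_witness Q r \<in> span J"
    using J(2) r(1) supp(3) span_mono unfolding witness_closed_def by blast
  then show "\<exists>R. finite R \<and> R \<subseteq> Q \<inter> span J \<and> (\<forall>e\<in>Q \<inter> span J. b \<le> e \<longrightarrow> (\<exists>r\<in>R. r \<le> e))"
    using r(3) lower_witness[OF *]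
    by (intro exI[of _ "{lower_witness Q r}"]) (auto intro: order.trans)
qed

text \<open>A finite support inside the union of a chain lies in one member. \<open>K\<close> is
  nonempty because \<open>span {}\<close> is not empty.\<close>

lemma span_UN_chain:
  assumes "K \<noteq> {}" "\<forall>k\<in>K. \<forall>l\<in>K. M k \<subseteq> M l \<or> M l \<subseteq> M k"
  shows "span (\<Union>k\<in>K. M k) = (\<Union>k\<in>K. span (M k))"
proof
  show "span (\<Union>k\<in>K. M k) \<subseteq> (\<Union>k\<in>K. span (M k))"
  proof
    fix x assume "x \<in> span (\<Union>k\<in>K. M k)"
    then obtain F where F: "finite F" "F \<subseteq> (\<Union>k\<in>K. M k)" "x \<in> span F"
      using span_finitary by blast
    have "subset.chain UNIV (M ` K)" using assms(2) unfolding subset_chain_def by blast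
    then obtain k where "k \<in> K" "F \<subseteq> M k"
      using finite_subset_Union_chain[OF F(1,2)] assms(1) by blast
    then show "x \<in> (\<Union>k\<in>K. span (M k))" using F(3) span_mono by blast
  qed
  show "(\<Union>k\<in>K. span (M k)) \<subseteq> span (\<Union>k\<in>K. M k)"
    by (intro UN_least span_mono) blast
qed

lemma witness_closed_UN_chain:
  assumes "K \<noteq> {}" "\<forall>k\<in>K. \<forall>l\<in>K. M k \<subseteq> M l \<or> M l \<subseteq> M k"
    and "\<And>k. k \<in> K \<Longrightarrow> witness_closed Q (M k)"
  shows "witness_closed Q (\<Union>k\<in>K. M k)"
  unfolding witness_closed_def
proof (intro ballI impI)
  fix r assume "r \<in> span (\<Union>k\<in>K. M k)" and r: "\<exists>q\<in>Q. q \<le> r"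
  then obtain k where k: "k \<in> K" "r \<in> span (M k)"
    using span_UN_chain[OF assms(1,2)] by auto
  then have "supp (lower_witness Q r) \<subseteq> M k"
    using assms(3)[OF k(1)] r unfolding witness_closed_def by auto
  then show "supp (lower_witness Q r) \<subseteq> (\<Union>k\<in>K. M k)" using k(1) by auto
qed

text \<open>Monotonicity of \<open>span\<close> makes intersections of closed sets closed, so the
  hull is the least closed superset.\<close>

lemma witness_closed_hull: "witness_closed Q (witness_closed Q hull J)"
proof (rule hull_in)
  fix T assume T: "Ball T (witness_closed Q)"
  have "span (\<Inter>T) \<subseteq> span K" if "K \<in> T" for K
    using that by (intro span_mono) blast
  then show "witness_closed Q (\<Inter>T)"
    using T unfolding witness_closed_def by (meson Inter_greatest subsetD)
qed

text \<open>Each of countably many stages adds a finite support for each of at most \<open>r\<close>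
  elements. The cardinal \<open>r\<close> is arbitrary since bounds above \<open>\<kappa>\<close>
  are used as well.\<close>

lemma card_of_witness_closed_hull:
  assumes r: "Cinfinite r" and A: "\<forall>i\<in>I. |A i| \<le>o r" and J: "J \<subseteq> I" "|J| \<le>o r"
  shows "|witness_closed Q hull J| \<le>o r"
proof -
  note inf = conjunct1[OF r, unfolded cinfinite_def] and co = conjunct2[OF r]
  \<comment> \<open>The factors are bounded only on \<open>I\<close>; intersecting with
    \<open>I\<close> gives the size bound for every \<open>K\<close>. The stages starting from
    \<open>J\<close> stay inside \<open>I\<close>.\<close>
  define F where "F K = K \<union> (\<Union>x\<in>span (K \<inter> I). supp (lower_witness Q x))" for K
  have F: "|F K| \<le>o r" if K: "|K| \<le>o r" for K
  proof -
    have "|K \<inter> I| \<le>o r" using K card_of_mono1[OF Int_lower1] ordLeq_transitive by blast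
    then have "|span (K \<inter> I)| \<le>o r" using card_of_span[OF r] A by blast
    moreover have "|supp x| \<le>o r" for x
      by (intro ordLess_imp_ordLeq card_of_finite_ordLess_Cinfinite r supp(1))
    ultimately have "|\<Union>x\<in>span (K \<inter> I). supp (lower_witness Q x)| \<le>o r"
      by (intro card_of_UNION_ordLeq_infinite_Field[OF inf co] ballI)
    then show ?thesis
      unfolding F_def by (rule card_of_Un_ordLeq_infinite_Field[OF inf K _ co])
  qed
  let ?T = "\<Union>n::nat. (F ^^ n) J"
  have sub: "(F ^^ n) J \<subseteq> I" for n
    by (induction n) (use J supp(2) in \<open>auto simp: F_def\<close>)
  have mono: "mono (\<lambda>n. (F ^^ n) J)"
    unfolding mono_iff_le_Suc by (auto simp: F_def)
  have chain: "(F ^^ k) J \<subseteq> (F ^^ l) J \<or> (F ^^ l) J \<subseteq> (F ^^ k) J" for k l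
    using monoD[OF mono, of k l] monoD[OF mono, of l k] by linarith
  have "witness_closed Q ?T"
    unfolding witness_closed_def
  proof (intro ballI impI)
    fix x assume "x \<in> span ?T"
    then obtain n where "x \<in> span ((F ^^ n) J)"
      using span_UN_chain[of UNIV "\<lambda>n. (F ^^ n) J"] chain by blast
    then have "supp (lower_witness Q x) \<subseteq> (F ^^ Suc n) J"
      using sub[of n] by (auto simp: F_def Int_absorb2)
    then show "supp (lower_witness Q x) \<subseteq> ?T" by blast
  qed
  moreover have "J \<subseteq> ?T" using UN_upper[of 0 UNIV "\<lambda>n. (F ^^ n) J"] by simp
  ultimately have "witness_closed Q hull J \<subseteq> ?T" by (simp add: hull_minimal)
  then show ?thesis
    by (rule ordLeq_transitive[OF card_of_mono1 card_of_funpow_closure[OF r J(2) F]])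
qed

section \<open>Induction on the size of the index set\<close>

lemma layered_span:
  assumes \<kappa>: "Cinfinite \<kappa>" and A: "\<forall>i\<in>I. |A i| \<le>o \<kappa>"
  shows "J \<subseteq> I \<Longrightarrow> witness_closed Q J \<Longrightarrow> layered \<kappa> Q (Q \<inter> span J)"
proof (induction "|J|" arbitrary: J rule: wf_induct_rule[OF wf_ordLess, case_names less])
  case less
  have wo: "Well_order \<kappa>" using \<kappa> by (simp add: card_order_on_def)
  show ?case
  proof (cases "|J| \<le>o \<kappa>")
    case True
    then have "|span J| \<le>o \<kappa>" using card_of_span[OF \<kappa> True] A less.prems(1) by blast
    then show ?thesis
      by (rule layered_small[OF ordLeq_transitive[OF card_of_mono1[OF Int_lower2]]])
  next
    case False
    then have large: "\<kappa> <o |J|"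
      using not_ordLeq_iff_ordLess[OF wo card_of_Well_order] by blast
    define r where "r = |J|"
    have r: "Card_order r" "Field r = J" "Well_order r"
      unfolding r_def by (auto simp: Field_card_of card_of_card_order_on card_of_well_order_on)
    have infJ: "infinite J"
      using large \<kappa> card_of_ordLeq_infinite[of "Field \<kappa>" J] card_of_Field_ordIso[of \<kappa>]
        ordIso_ordLeq_trans ordLess_imp_ordLeq unfolding cinfinite_def by blast
    \<comment> \<open>\<open>under\<close> includes \<open>j\<close> itself, so these hulls exhaust
      \<open>J\<close>; they stay inside \<open>J\<close> because \<open>J\<close> is
      closed.\<close>
    define M where "M j = witness_closed Q hull (under r j)" for j
    have under: "under r j \<subseteq> J" for j
      unfolding r(2)[symmetric] under_def Field_def by blast
    have MJ: "M j \<subseteq> J" for j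
      unfolding M_def by (rule hull_minimal[where S="witness_closed Q", OF under less.prems(2)])
    have Mcl: "witness_closed Q (M j)" for j
      unfolding M_def by (rule witness_closed_hull)
    have self: "j \<in> M j" if "j \<in> J" for j
    proof -
      have "j \<in> under r j"
        using r that unfolding well_order_on_def linear_order_on_def partial_order_on_def
          preorder_on_def refl_on_def under_def by blast
      then show ?thesis unfolding M_def by (rule hull_inc)
    qed
    have JM: "J = (\<Union>j\<in>J. M j)" using MJ self by blast
    have chain: "M k \<subseteq> M l \<or> M l \<subseteq> M k" if "k \<in> J" "l \<in> J" for k l
    proof -
      have "under r k \<subseteq> under r l \<or> under r l \<subseteq> under r k"
      proof -
        have "trans r" "k = l \<or> (k, l) \<in> r \<or> (l, k) \<in> r"
          using r(2,3) that unfolding well_order_on_def linear_order_on_def partial_order_on_def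
            preorder_on_def total_on_def by blast+
        then show ?thesis unfolding under_def by (auto dest: transD)
      qed
      then show ?thesis unfolding M_def using hull_mono by metis
    qed
    \<comment> \<open>The hull has at most the larger of \<open>\<kappa>\<close> and
      \<open>|under r j|\<close> many elements, and both are below \<open>|J|\<close>.\<close>
    have small: "|M j| <o |J|" if "j \<in> J" for j
    proof -
      have "under r j \<subseteq> underS r j \<union> {j}" unfolding under_def underS_def by blast
      moreover have "|underS r j \<union> {j}| <o |J|"
      proof (rule card_of_Un_ordLess_infinite[OF infJ])
        show "|underS r j| <o |J|"
          using card_of_underS[OF r(1), of j] r(2) that unfolding r_def by simp
        show "|{j}| <o |J|"
          using infJ by (intro card_of_finite_ordLess_Cinfinite)
            (auto simp: cinfinite_def card_of_card_order_on Field_card_of)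
      qed
      ultimately have u: "|under r j| <o |J|"
        by (rule ordLeq_ordLess_trans[OF card_of_mono1])
      have uI: "under r j \<subseteq> I" using under less.prems(1) by blast
      show ?thesis
      proof (cases "|under r j| \<le>o \<kappa>")
        case True
        then have "|M j| \<le>o \<kappa>"
          unfolding M_def by (rule card_of_witness_closed_hull[OF \<kappa> A uI])
        then show ?thesis using large by (rule ordLeq_ordLess_trans)
      next
        case False
        then have l: "\<kappa> \<le>o |under r j|"
          using ordLeq_total[OF wo card_of_Well_order] by blast
        then have "Cinfinite |under r j|"
          using cinfinite_mono[OF l] \<kappa> card_of_Card_order by blast
        moreover have "\<forall>i\<in>I. |A i| \<le>o |under r j|" using A l ordLeq_transitive by blast
        ultimately have "|M j| \<le>o |under r j|"
          unfolding M_def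
          by (rule card_of_witness_closed_hull[OF _ _ uI ordLeq_reflexive[OF card_of_Well_order]])
        then show ?thesis using u by (rule ordLeq_ordLess_trans)
      qed
    qed
    have "layered \<kappa> Q (\<Union>j\<in>Field r. Q \<inter> span (M j))"
    proof (rule layered_UN[OF r(3)])
      fix k assume "k \<in> Field r"
      then have k: "k \<in> J" using r by simp
      show "layered \<kappa> Q (Q \<inter> span (M k))"
        using less.hyps[OF small[OF k] _ Mcl] MJ less.prems(1) by blast
      \<comment> \<open>At a limit position the earlier pieces need not have a largest one, but a
        union of a chain of closed sets is again closed.\<close>
      show "finitely_covered Q (\<Union>l\<in>underS r k. Q \<inter> span (M l))"
      proof (cases "underS r k = {}")
        case True
        then show ?thesis by (simp add: finitely_covered_empty)
      next
        case False
        have sub: "underS r k \<subseteq> J" unfolding r(2)[symmetric] underS_def Field_def by blast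
        then have ch: "\<forall>a\<in>underS r k. \<forall>b\<in>underS r k. M a \<subseteq> M b \<or> M b \<subseteq> M a"
          using chain by blast
        have "(\<Union>l\<in>underS r k. Q \<inter> span (M l)) = Q \<inter> span (\<Union>l\<in>underS r k. M l)"
          unfolding span_UN_chain[of "underS r k" M, OF False ch] by blast
        moreover have "(\<Union>l\<in>underS r k. M l) \<subseteq> I" using MJ less.prems(1) by blast
        ultimately show ?thesis
          using finitely_covered_span
            witness_closed_UN_chain[of "underS r k" M, OF False ch Mcl] by presburger
      qed
    qed
    moreover have "span J = (\<Union>j\<in>J. span (M j))"
    proof -
      have "J \<noteq> {}" using infJ by auto
      from span_UN_chain[of J M, OF this] show ?thesis using JM chain by simp
    qed
    ultimately show ?thesis by (simp add: r(2))
  qed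
qed

end

theorem theorem3p8:
  fixes \<kappa> :: "'k rel" and I :: "'i set" and A :: "'i \<Rightarrow> 'a::boolean_algebra set"
  assumes "Card_order \<kappa>" and "(natLeq, \<kappa>) \<in> ordLeq"
    and "free_product_of I A"
    and "\<forall>i\<in>I. (card_of (A i), \<kappa>) \<in> ordLeq"
  shows "\<forall>Q :: 'a set. almost_op_like \<kappa> Q"
proof
  fix Q :: "'a set"
  interpret free_product I A by unfold_locales (rule assms(3))
  have \<kappa>: "Cinfinite \<kappa>"
    using assms(1,2) cinfinite_mono natLeq_cinfinite by blast
  have "witness_closed Q I"
    unfolding witness_closed_def using supp(2) by blast
  then have "layered \<kappa> Q (Q \<inter> span I)" using layered_span[OF \<kappa> assms(4)] by blast
  then show "almost_op_like \<kappa> Q"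
    using almost_op_like_layered[OF \<kappa>] by (simp add: span_UNIV)
qed

end
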